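(* Consider a well-formed cross-chain deal executed with the timelock protocol in the synchronous communication model with bound $\Delta$, where an arbitrary number of the participating parties may be deviating. Then the timelock protocol satisfies safety: for every protocol execution, every compliant party ends up with an acceptable payoff.
   Context: **Parties, assets, contracts.** A deal $D$ involves a finite list $\mathit{plist}$ of $N$ parties. Each asset has exactly one owner at a time and lives on a blockchain. A blockchain is a publicly readable, tamper-proof ledger that can host contracts. Contracts are public, deterministic, passive, trusted programs, which see only data on their own blockchain or data submitted to them by parties. Every party can read the state of any contract. Signatures cannot be forged and messages cannot be replayed (deal identifiers are unique). A party is *compliant* if it follows the protocol below. Otherwise it is *deviating* and may behave arbitrarily. There is no bound on the number of deviating parties. **Deal.** A deal specifies a set of transfers of assets between parties. It is viewed as a directed graph whose vertices are the parties and whose arcs are the transfers. A transfer from $P$ to $Q$ is an *outgoing* transfer (asset) of $P$ and an *incoming* transfer (asset) of $Q$. A party may relay an asset, so the same asset can be both incoming and outgoing for a party. The deal is *well-formed*, which here means that its digraph is strongly connected. **Payoffs.** A party's payoff in an execution is the pair consisting of the set of its incoming assets and the set of its outgoing assets actually (permanently) transferred. Each party has a set of *acceptable* payoffs such that: (i) ALL (all agreed transfers take place) and NOTHING (no transfers take place) are acceptable; (ii) if a payoff is acceptable to a party, so is any payoff in which that party receives strictly more incoming assets or gives up strictly fewer outgoing assets. Other payoffs may or may not be acceptable. **Synchronous model.** $\Delta>0$ is a known bound on propagation time. If a vote is accepted by a contract at time $t$, a compliant party monitoring that contract can observe it and have it delivered, forwarded, to other contracts by time $t+\Delta$. **Timelock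 protocol.** 1. *Clearing.* All parties are sent $D$, $\mathit{plist}$, a commit-phase starting time $t_0$ and $\Delta$ by an untrusted service. The time $t_0$ is far enough in the future for the escrow, transfer and validation steps of compliant parties to finish before it. 2. *Escrow.* The owner of an asset $a$ (who must be in $\mathit{plist}$) may place it in escrow with an escrow contract on $a$'s blockchain, recording $D,\mathit{plist},t_0,\Delta$. The contract becomes the owner of $a$. The contract records an abort-owner $A(a)$ and a commit-owner $C(a)$, both initially the escrowing party. Each compliant party escrows its outgoing assets that it initially owns. 3. *Transfer.* The current commit-owner $P=C(a)$ of an escrowed asset $a$ (and only $P$) may tentatively transfer it to a party $Q\in\mathit{plist}$, which sets $C(a):=Q$. Compliant parties perform the tentative transfers specified by the deal. 4. *Validation.* Each compliant party checks that its incoming assets are properly escrowed with the correct deal information, and that the payoff in which all its tentatively transferred incoming and outgoing assets are transferred is acceptable to it. If so it votes to commit. Otherwise it does not vote. 5. *Commit.* A vote of party $v$ carries a *path signature* $p$, a sequence of signatures beginning with $v$'s and followed by those of the successive parties that forwarded it. $|p|$ denotes the number of distinct signers. A compliant party that votes to commit sends its directly signed vote ($|p|=1$) to the escrow contract of each of its incoming assets, arriving before $t_0+\Delta$. It also monitors the escrow contracts of its outgoing assets. Whenever a new vote of some party (with path signature $p$) is accepted there, it appends its own signature and forwards the vote to the escrow contracts of all its incoming assets, unless it has already done so for that voter. (It may also send votes to other contracts.) A contract accepts a vote of $v$ with path signature $p$ if and only if it arrives before time $t_0+|p|\cdot\Delta$, all signers in $p$ are distinct members of $\mathit{plist}$,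 and all signatures are valid and attest to a vote from $v$. 6. *Release or refund.* When an escrow contract has accepted a commit vote from every party in $\mathit{plist}$, it releases its escrowed asset $a$ to $C(a)$, so the tentative transfers of $a$ become permanent. If it has not accepted a vote from every party by time $t_0+N\cdot\Delta$, it times out and refunds $a$ to $A(a)$, so no transfer of $a$ takes place. *)

theory Defs
  imports Complex_Main "Graph_Theory.Digraph_Component"
begin

section \<open>Deals and payoffs\<close>

text \<open>
  Type variables: \<open>'d\<close> deal identifiers, \<open>'p\<close> parties, \<open>'a\<close> assets.
  A triple \<open>(P, Q, a)\<close> is the transfer of asset \<open>a\<close> from \<open>P\<close> to \<open>Q\<close>.
\<close>

record ('d, 'p, 'a) deal =
  deal_id :: 'd
  transfers :: "('p \<times> 'p \<times> 'a) set"

definition deal_graph :: "('d, 'p, 'a) deal \<Rightarrow> 'p list \<Rightarrow> ('p, 'p \<times> 'p \<times> 'a) pre_digraph" where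
  "deal_graph D ps = \<lparr>verts = set ps, arcs = transfers D, tail = fst, head = fst \<circ> snd\<rparr>"

text \<open>
  A party can only be asked to transfer an asset that it owns at the beginning (the map \<open>own\<close>)
  or that it relays, i.e. that is also one of its incoming assets.
\<close>

definition deal_among :: "('a \<Rightarrow> 'p) \<Rightarrow> ('d, 'p, 'a) deal \<Rightarrow> 'p list \<Rightarrow> bool" where
  "deal_among own D ps \<longleftrightarrow>
     distinct ps \<and> wf_digraph (deal_graph D ps) \<and>
     (\<forall>P Q a. (P, Q, a) \<in> transfers D \<longrightarrow> own a = P \<or> (\<exists>R. (R, P, a) \<in> transfers D))"

definition well_formed :: "('d, 'p, 'a) deal \<Rightarrow> 'p list \<Rightarrow> bool" where
  "well_formed D ps \<longleftrightarrow> strongly_connected (deal_graph D ps)"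

definition incoming :: "('d, 'p, 'a) deal \<Rightarrow> 'p \<Rightarrow> 'a set" where
  "incoming D P = {a. \<exists>R. (R, P, a) \<in> transfers D}"

definition outgoing :: "('d, 'p, 'a) deal \<Rightarrow> 'p \<Rightarrow> 'a set" where
  "outgoing D P = {a. \<exists>Q. (P, Q, a) \<in> transfers D}"

type_synonym 'a payoff = "'a set \<times> 'a set"

definition payoff_of :: "('d, 'p, 'a) deal \<Rightarrow> ('p \<times> 'p \<times> 'a) set \<Rightarrow> 'p \<Rightarrow> 'a payoff" where
  "payoff_of D T P =
     ({a \<in> incoming D P. \<exists>R. (R, P, a) \<in> T}, {a \<in> outgoing D P. \<exists>Q. (P, Q, a) \<in> T})"

definition acceptability :: "('d, 'p, 'a) deal \<Rightarrow> 'p \<Rightarrow> 'a payoff set \<Rightarrow> bool" where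
  "acceptability D P S \<longleftrightarrow>
     S \<subseteq> Pow (incoming D P) \<times> Pow (outgoing D P) \<and>
     (incoming D P, outgoing D P) \<in> S \<and>
     ({}, {}) \<in> S \<and>
     (\<forall>I G I' G'. (I, G) \<in> S \<and> I' \<subseteq> incoming D P \<and> G' \<subseteq> outgoing D P \<and>
        (I \<subset> I' \<and> G' \<subseteq> G \<or> I \<subseteq> I' \<and> G' \<subset> G) \<longrightarrow> (I', G') \<in> S)"


section \<open>Blockchain state and contract behaviour\<close>

text \<open>The data \<open>D, plist, t\<^sub>0, \<Delta>\<close> recorded by an escrow contract.\<close>

record ('d, 'p, 'a) info =
  the_deal :: "('d, 'p, 'a) deal"
  plist :: "'p list"
  start :: real
  delta :: real

record ('d, 'p, 'a) escrow =
  recorded :: "('d, 'p, 'a) info"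
  abort_owner :: 'p
  commit_owner :: 'p
  tentative :: "('p \<times> 'p) set"
  voters :: "'p set"

datatype ('d, 'p, 'a) holding = Owned 'p | Escrowed "('d, 'p, 'a) escrow"

text \<open>
  \<open>permanent\<close> collects all permanent transfers.  \<open>(s, d, v) \<in> signatures\<close> means that \<open>s\<close> has
  signed a statement attesting to a commit vote of \<open>v\<close> in the deal with identifier \<open>d\<close>; a
  signature is valid iff it occurs here (unforgeability), and it names the deal (no replay).
\<close>

record ('d, 'p, 'a) state =
  holding_of :: "'a \<Rightarrow> ('d, 'p, 'a) holding"
  permanent :: "('p \<times> 'p \<times> 'a) set"
  signatures :: "('p \<times> 'd \<times> 'p) set"

text \<open>
  \<open>Hand_Over\<close> is an ownership change outside the protocol.  \<open>Vote a v p\<close> is the arrival, at the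
  escrow contract of \<open>a\<close>, of a vote of \<open>v\<close> whose path signature consists of signatures
  purportedly by the parties in \<open>p\<close>; anyone may submit it.  \<open>Sign\<close> and \<open>Validate\<close> are off-chain.
\<close>

datatype ('d, 'p, 'a) event =
    Escrow 'p 'a "('d, 'p, 'a) info"
  | Transfer 'p 'a 'p
  | Hand_Over 'p 'a 'p
  | Vote 'a 'p "'p list"
  | Timeout 'a
  | Sign 'p 'd 'p
  | Validate 'p

definition accepts :: "real \<Rightarrow> ('p \<times> 'd \<times> 'p) set \<Rightarrow> ('d, 'p, 'a) info \<Rightarrow> 'p \<Rightarrow> 'p list \<Rightarrow> bool" where
  "accepts t S J v p \<longleftrightarrow>
     t < start J + real (card (set p)) * delta J \<and>
     p \<noteq> [] \<and> hd p = v \<and> distinct p \<and> set p \<subseteq> set (plist J) \<and>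
     (\<forall>s \<in> set p. (s, deal_id (the_deal J), v) \<in> S)"

definition tag :: "'a \<Rightarrow> ('p \<times> 'p) set \<Rightarrow> ('p \<times> 'p \<times> 'a) set" where
  "tag a T = {(P, Q, b). (P, Q) \<in> T \<and> b = a}"

text \<open>
  Calls that a contract does not allow have no effect.  Refunding at some time at or after the
  timeout is harmless: no vote can be accepted from the timeout on, as path signatures have at
  most \<open>N\<close> distinct signers.
\<close>

fun step :: "real \<Rightarrow> ('d, 'p, 'a) event \<Rightarrow> ('d, 'p, 'a) state \<Rightarrow> ('d, 'p, 'a) state" where
  "step t (Escrow P a J) \<sigma> =
     (if holding_of \<sigma> a = Owned P \<and> P \<in> set (plist J)
      then \<sigma>\<lparr>holding_of := (holding_of \<sigma>)(a := Escrowed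
             \<lparr>recorded = J, abort_owner = P, commit_owner = P, tentative = {}, voters = {}\<rparr>)\<rparr>
      else \<sigma>)"
| "step t (Transfer P a Q) \<sigma> =
     (case holding_of \<sigma> a of
        Owned _ \<Rightarrow> \<sigma>
      | Escrowed c \<Rightarrow>
          if commit_owner c = P \<and> Q \<in> set (plist (recorded c))
          then \<sigma>\<lparr>holding_of := (holding_of \<sigma>)(a := Escrowed
                 (c\<lparr>commit_owner := Q, tentative := insert (P, Q) (tentative c)\<rparr>))\<rparr>
          else \<sigma>)"
| "step t (Hand_Over P a Q) \<sigma> =
     (if holding_of \<sigma> a = Owned P
      then \<sigma>\<lparr>holding_of := (holding_of \<sigma>)(a := Owned Q),
             permanent := insert (P, Q, a) (permanent \<sigma>)\<rparr>
      else \<sigma>)"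
| "step t (Vote a v p) \<sigma> =
     (case holding_of \<sigma> a of
        Owned _ \<Rightarrow> \<sigma>
      | Escrowed c \<Rightarrow>
          if accepts t (signatures \<sigma>) (recorded c) v p
          then (if set (plist (recorded c)) \<subseteq> insert v (voters c)
                then \<sigma>\<lparr>holding_of := (holding_of \<sigma>)(a := Owned (commit_owner c)),
                       permanent := permanent \<sigma> \<union> tag a (tentative c)\<rparr>
                else \<sigma>\<lparr>holding_of := (holding_of \<sigma>)(a := Escrowed
                       (c\<lparr>voters := insert v (voters c)\<rparr>))\<rparr>)
          else \<sigma>)"
| "step t (Timeout a) \<sigma> =
     (case holding_of \<sigma> a of
        Owned _ \<Rightarrow> \<sigma>
      | Escrowed c \<Rightarrow>
          if start (recorded c) + real (length (plist (recorded c))) * delta (recorded c) \<le> t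
          then \<sigma>\<lparr>holding_of := (holding_of \<sigma>)(a := Owned (abort_owner c))\<rparr>
          else \<sigma>)"
| "step t (Sign s d v) \<sigma> = \<sigma>\<lparr>signatures := insert (s, d, v) (signatures \<sigma>)\<rparr>"
| "step t (Validate P) \<sigma> = \<sigma>"

definition init_state :: "('a \<Rightarrow> 'p) \<Rightarrow> ('d, 'p, 'a) state" where
  "init_state own = \<lparr>holding_of = (\<lambda>a. Owned (own a)), permanent = {}, signatures = {}\<rparr>"

type_synonym ('d, 'p, 'a) trace = "(real \<times> ('d, 'p, 'a) event) list"

text \<open>The state just before the event with index \<open>i\<close>.\<close>

definition state_at :: "('a \<Rightarrow> 'p) \<Rightarrow> ('d, 'p, 'a) trace \<Rightarrow> nat \<Rightarrow> ('d, 'p, 'a) state" where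
  "state_at own tr i = fold (\<lambda>(t, e). step t e) (take i tr) (init_state own)"

definition final_state :: "('a \<Rightarrow> 'p) \<Rightarrow> ('d, 'p, 'a) trace \<Rightarrow> ('d, 'p, 'a) state" where
  "final_state own tr = state_at own tr (length tr)"

definition time_at :: "('d, 'p, 'a) trace \<Rightarrow> nat \<Rightarrow> real" where
  "time_at tr i = fst (tr ! i)"

definition occurs :: "('d, 'p, 'a) trace \<Rightarrow> nat \<Rightarrow> ('d, 'p, 'a) event \<Rightarrow> bool" where
  "occurs tr i e \<longleftrightarrow> i < length tr \<and> snd (tr ! i) = e"


section \<open>Compliant parties\<close>

text \<open>
  Throughout, \<open>J\<close> is the deal information sent to the parties in the clearing phase, \<open>X\<close> is a
  compliant party and \<open>j\<close> is the index of its validation step.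
\<close>

definition escrow_phase ::
  "('a \<Rightarrow> 'p) \<Rightarrow> ('d, 'p, 'a) info \<Rightarrow> ('d, 'p, 'a) trace \<Rightarrow> 'p \<Rightarrow> nat \<Rightarrow> bool" where
  "escrow_phase own J tr X j \<longleftrightarrow>
     (\<forall>a \<in> outgoing (the_deal J) X. own a = X \<longrightarrow> (\<exists>i<j. occurs tr i (Escrow X a J))) \<and>
     (\<forall>i a J'. occurs tr i (Escrow X a J') \<longrightarrow>
        i < j \<and> J' = J \<and> a \<in> outgoing (the_deal J) X \<and> own a = X) \<and>
     (\<forall>i a Q. \<not> occurs tr i (Hand_Over X a Q))"

text \<open>
  A party that is still commit-owner of a correctly escrowed asset when it validates has no
  transfer of that asset left to perform.
\<close>

definition transfer_phase ::
  "('a \<Rightarrow> 'p) \<Rightarrow> ('d, 'p, 'a) info \<Rightarrow> ('d, 'p, 'a) trace \<Rightarrow> 'p \<Rightarrow> nat \<Rightarrow> bool" where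
  "transfer_phase own J tr X j \<longleftrightarrow>
     (\<forall>i a Q. occurs tr i (Transfer X a Q) \<longrightarrow> i < j \<and> (X, Q, a) \<in> transfers (the_deal J)) \<and>
     (\<forall>a Q c. (X, Q, a) \<in> transfers (the_deal J) \<and>
        holding_of (state_at own tr j) a = Escrowed c \<and> recorded c = J \<and> commit_owner c = X \<longrightarrow>
        (X, Q) \<in> tentative c)"

definition tentative_transfers :: "('d, 'p, 'a) state \<Rightarrow> ('p \<times> 'p \<times> 'a) set" where
  "tentative_transfers \<sigma> =
     {(P, Q, a). \<exists>c. holding_of \<sigma> a = Escrowed c \<and> (P, Q) \<in> tentative c}"

definition validation_ok ::
  "('a \<Rightarrow> 'p) \<Rightarrow> ('d, 'p, 'a) info \<Rightarrow> 'a payoff set \<Rightarrow> ('d, 'p, 'a) trace \<Rightarrow> 'p \<Rightarrow> nat \<Rightarrow> bool" where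
  "validation_ok own J S tr X j \<longleftrightarrow>
     (\<forall>a \<in> incoming (the_deal J) X.
        \<exists>c. holding_of (state_at own tr j) a = Escrowed c \<and> recorded c = J) \<and>
     payoff_of (the_deal J) (tentative_transfers (state_at own tr j)) X \<in> S"

text \<open>
  The vote arriving as event \<open>i\<close> is accepted by the (correctly set up) escrow contract of some
  outgoing asset of \<open>X\<close>.
\<close>

definition observed_vote ::
  "('a \<Rightarrow> 'p) \<Rightarrow> ('d, 'p, 'a) info \<Rightarrow> ('d, 'p, 'a) trace \<Rightarrow> 'p \<Rightarrow> nat \<Rightarrow> 'p \<Rightarrow> 'p list \<Rightarrow> bool" where
  "observed_vote own J tr X i v p \<longleftrightarrow>
     (\<exists>a \<in> outgoing (the_deal J) X. \<exists>c. occurs tr i (Vote a v p) \<and>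
        holding_of (state_at own tr i) a = Escrowed c \<and> recorded c = J \<and>
        accepts (time_at tr i) (signatures (state_at own tr i)) J v p)"

definition votes_directly ::
  "('d, 'p, 'a) info \<Rightarrow> ('d, 'p, 'a) trace \<Rightarrow> 'p \<Rightarrow> nat \<Rightarrow> bool" where
  "votes_directly J tr X j \<longleftrightarrow>
     (\<exists>k>j. occurs tr k (Sign X (deal_id (the_deal J)) X) \<and>
        (\<forall>b \<in> incoming (the_deal J) X.
           \<exists>m>k. occurs tr m (Vote b X [X]) \<and> time_at tr m < start J + delta J))"

text \<open>
  The vote accepted as event \<open>i\<close> is signed and delivered to the escrow contracts of all incoming
  assets within \<open>\<Delta>\<close>.  If it had been accepted before \<open>X\<close> validated, the delay counts from
  the validation.
\<close>

definition forwards ::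
  "('a \<Rightarrow> 'p) \<Rightarrow> ('d, 'p, 'a) info \<Rightarrow> ('d, 'p, 'a) trace \<Rightarrow> 'p \<Rightarrow> nat \<Rightarrow> nat \<Rightarrow> 'p \<Rightarrow> bool" where
  "forwards own J tr X j i v \<longleftrightarrow>
     (\<exists>p. observed_vote own J tr X i v p \<and> X \<notin> set p \<and>
        (\<exists>k>max i j. occurs tr k (Sign X (deal_id (the_deal J)) v) \<and>
           (\<forall>b \<in> incoming (the_deal J) X.
              \<exists>m>k. occurs tr m (Vote b v (p @ [X])) \<and>
                time_at tr m \<le> max (time_at tr i) (time_at tr j) + delta J)))"

text \<open>
  Once a vote of \<open>v\<close> has been observed, that one or an earlier one of \<open>v\<close> is forwarded (the latter
  covers votes already forwarded).  Conversely, \<open>X\<close> signs nothing but its own vote and votes it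
  forwards, and these only after a successful validation.
\<close>

definition commit_phase ::
  "('a \<Rightarrow> 'p) \<Rightarrow> ('d, 'p, 'a) info \<Rightarrow> 'a payoff set \<Rightarrow> ('d, 'p, 'a) trace \<Rightarrow> 'p \<Rightarrow> nat \<Rightarrow> bool" where
  "commit_phase own J S tr X j \<longleftrightarrow>
     (validation_ok own J S tr X j \<longrightarrow>
        votes_directly J tr X j \<and>
        (\<forall>i v p. v \<noteq> X \<and> observed_vote own J tr X i v p \<longrightarrow>
           (\<exists>i'\<le>i. forwards own J tr X j i' v))) \<and>
     (\<forall>k d v. occurs tr k (Sign X d v) \<longrightarrow>
        validation_ok own J S tr X j \<and> j < k \<and> d = deal_id (the_deal J) \<and>
        (v = X \<or> (\<exists>i<k. forwards own J tr X j i v)))"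

definition compliant ::
  "('a \<Rightarrow> 'p) \<Rightarrow> ('d, 'p, 'a) info \<Rightarrow> 'a payoff set \<Rightarrow> ('d, 'p, 'a) trace \<Rightarrow> 'p \<Rightarrow> bool" where
  "compliant own J S tr X \<longleftrightarrow>
     (\<exists>j. occurs tr j (Validate X) \<and> time_at tr j < start J \<and>
        escrow_phase own J tr X j \<and>
        transfer_phase own J tr X j \<and>
        commit_phase own J S tr X j)"

text \<open>
  A complete execution: every escrow has been released or refunded at the end.  Parties outside
  \<open>C\<close> are unconstrained.
\<close>

definition execution ::
  "('a \<Rightarrow> 'p) \<Rightarrow> ('d, 'p, 'a) info \<Rightarrow> ('p \<Rightarrow> 'a payoff set) \<Rightarrow> 'p set \<Rightarrow> ('d, 'p, 'a) trace \<Rightarrow> bool" where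
  "execution own J acc C tr \<longleftrightarrow>
     sorted (map fst tr) \<and>
     (\<forall>P \<in> C. compliant own J (acc P) tr P) \<and>
     (\<forall>a c. holding_of (final_state own tr) a \<noteq> Escrowed c)"

definition final_payoff ::
  "('a \<Rightarrow> 'p) \<Rightarrow> ('d, 'p, 'a) info \<Rightarrow> ('d, 'p, 'a) trace \<Rightarrow> 'p \<Rightarrow> 'a payoff" where
  "final_payoff own J tr P = payoff_of (the_deal J) (permanent (final_state own tr)) P"

end

theory Submission
  imports Defs
begin

text \<open>
  Fix a compliant party \<open>X\<close>.  A contract that \<open>X\<close> uses lists \<open>X\<close> as a participant, so it cannot
  release its asset before \<open>X\<close> has signed its own vote, which happens only after a successful
  validation.  If validation fails, \<open>X\<close> therefore gives nothing away.  If it succeeds, all incoming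
  and outgoing assets of \<open>X\<close> are then held by correctly configured contracts.  When one outgoing
  asset is released later, its contract has accepted a vote of every party; \<open>X\<close> forwards each of
  these votes with one additional signature, which buys exactly the additional \<open>\<Delta>\<close> needed for
  the delivery, so every incoming contract accepts all votes as well.  Hence \<open>X\<close> receives all it
  has validated and gives away at most what it has validated.
\<close>

section \<open>Contract steps\<close>

lemma step_signatures:
  "x \<in> signatures (step t e \<sigma>) \<longleftrightarrow>
     x \<in> signatures \<sigma> \<or> (\<exists>s d v. e = Sign s d v \<and> x = (s, d, v))"
  by (cases e) (auto split: holding.splits)

lemma permanent_step_mono: "permanent \<sigma> \<subseteq> permanent (step t e \<sigma>)"
  by (cases e) (auto split: holding.splits)

lemma permanent_stepE:
  assumes "(P, Q, a) \<in> permanent (step t e \<sigma>)"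
  obtains "(P, Q, a) \<in> permanent \<sigma>"
  | "e = Hand_Over P a Q"
  | c v p where "e = Vote a v p" "holding_of \<sigma> a = Escrowed c"
      "accepts t (signatures \<sigma>) (recorded c) v p"
      "set (plist (recorded c)) \<subseteq> insert v (voters c)" "(P, Q) \<in> tentative c"
  using assms by (cases e) (auto simp: tag_def split: holding.splits if_splits)

text \<open>Read backwards from the contract found after the step: this form serves inductions that
  prove an invariant of all contracts.\<close>

lemma escrowed_stepE:
  assumes "holding_of (step t e \<sigma>) a = Escrowed c"
  obtains (new) P J where "e = Escrow P a J" "holding_of \<sigma> a = Owned P" "P \<in> set (plist J)"
      "c = \<lparr>recorded = J, abort_owner = P, commit_owner = P, tentative = {}, voters = {}\<rparr>"
  | (same) "holding_of \<sigma> a = Escrowed c"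
  | (transfer) c0 P Q where "holding_of \<sigma> a = Escrowed c0" "e = Transfer P a Q"
      "commit_owner c0 = P" "Q \<in> set (plist (recorded c0))"
      "c = c0\<lparr>commit_owner := Q, tentative := insert (P, Q) (tentative c0)\<rparr>"
  | (vote) c0 v p where "holding_of \<sigma> a = Escrowed c0" "e = Vote a v p"
      "accepts t (signatures \<sigma>) (recorded c0) v p"
      "\<not> set (plist (recorded c0)) \<subseteq> insert v (voters c0)"
      "c = c0\<lparr>voters := insert v (voters c0)\<rparr>"
proof (cases e)
  case (Escrow P b J)
  show ?thesis
  proof (cases "a = b \<and> holding_of \<sigma> a = Owned P \<and> P \<in> set (plist J)")
    case True
    then show ?thesis
      using assms Escrow by (intro new[of P J]) auto
  next
    case False
    then show ?thesis
      using assms Escrow by (intro same) (auto split: if_splits)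
  qed
next
  case (Transfer P b Q)
  show ?thesis
  proof (cases "\<exists>c0. a = b \<and> holding_of \<sigma> a = Escrowed c0 \<and> commit_owner c0 = P \<and>
      Q \<in> set (plist (recorded c0))")
    case True
    then obtain c0 where "a = b" "holding_of \<sigma> a = Escrowed c0" "commit_owner c0 = P"
        "Q \<in> set (plist (recorded c0))" by blast
    then show ?thesis
      using assms Transfer by (intro transfer[of c0 P Q]) auto
  next
    case False
    then show ?thesis
      using assms Transfer by (intro same) (auto split: holding.splits if_splits)
  qed
next
  case (Vote b v p)
  show ?thesis
  proof (cases "\<exists>c0. a = b \<and> holding_of \<sigma> a = Escrowed c0 \<and>
      accepts t (signatures \<sigma>) (recorded c0) v p")
    case True
    then obtain c0 where c0: "a = b" "holding_of \<sigma> a = Escrowed c0"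
        "accepts t (signatures \<sigma>) (recorded c0) v p" by blast
    then have "\<not> set (plist (recorded c0)) \<subseteq> insert v (voters c0)"
      using assms Vote by (auto split: if_splits)
    with c0 show ?thesis
      using assms Vote by (intro vote[of c0 v p]) auto
  next
    case False
    then show ?thesis
      using assms Vote by (intro same) (auto split: holding.splits if_splits)
  qed
qed (use assms same in \<open>auto split: holding.splits if_splits\<close>)

text \<open>The forward counterpart follows one contract. Only a completing vote or a refund ends
  it; until then its transfers and voters can only grow, and the last clause of \<open>stays\<close>
  says that no accepted vote is lost.\<close>

lemma step_escrowedE:
  assumes "holding_of \<sigma> a = Escrowed c"
  obtains (stays) c' where "holding_of (step t e \<sigma>) a = Escrowed c'" "recorded c' = recorded c"
      "tentative c \<subseteq> tentative c'" "voters c \<subseteq> voters c'"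
      "\<And>v p. e = Vote a v p \<Longrightarrow> accepts t (signatures \<sigma>) (recorded c) v p \<Longrightarrow> v \<in> voters c'"
  | (release) v p where "e = Vote a v p" "accepts t (signatures \<sigma>) (recorded c) v p"
      "set (plist (recorded c)) \<subseteq> insert v (voters c)"
      "tag a (tentative c) \<subseteq> permanent (step t e \<sigma>)"
  | (refund) "e = Timeout a"
      "start (recorded c) + real (length (plist (recorded c))) * delta (recorded c) \<le> t"
  using assms
proof (cases e)
  case (Vote b v p)
  show ?thesis
  proof (cases "b = a \<and> accepts t (signatures \<sigma>) (recorded c) v p")
    case accepted: True
    show ?thesis
    proof (cases "set (plist (recorded c)) \<subseteq> insert v (voters c)")
      case True
      with accepted show ?thesis
        using assms Vote by (intro release[of v p]) auto
    next
      case False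
      with accepted show ?thesis
        using assms Vote by (intro stays[of "c\<lparr>voters := insert v (voters c)\<rparr>"]) auto
    qed
  next
    case False
    then show ?thesis
      using assms Vote by (intro stays[of c]) (auto split: holding.splits if_splits)
  qed
next
  case (Transfer P b Q)
  show ?thesis
  proof (cases "b = a \<and> commit_owner c = P \<and> Q \<in> set (plist (recorded c))")
    case True
    then show ?thesis
      using assms Transfer
      by (intro stays[of "c\<lparr>commit_owner := Q, tentative := insert (P, Q) (tentative c)\<rparr>"]) auto
  next
    case False
    then show ?thesis
      using assms Transfer by (intro stays[of c]) (auto split: holding.splits if_splits)
  qed
next
  case (Timeout b)
  show ?thesis
  proof (cases "b = a \<and>
      start (recorded c) + real (length (plist (recorded c))) * delta (recorded c) \<le> t")
    case True
    then show ?thesis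
      using Timeout by (intro refund) auto
  next
    case False
    then show ?thesis
      using assms Timeout by (intro stays[of c]) (auto split: holding.splits if_splits)
  qed
qed (use assms in \<open>auto intro!: stays[of c]\<close>)

lemma owned_stepE:
  assumes "holding_of \<sigma> a = Owned P"
  obtains "holding_of (step t e \<sigma>) a = Owned P" "\<And>J. e = Escrow P a J \<Longrightarrow> P \<notin> set (plist J)"
  | Q where "e = Hand_Over P a Q"
  | J c where "e = Escrow P a J" "holding_of (step t e \<sigma>) a = Escrowed c" "recorded c = J"
proof (cases "(\<exists>Q. e = Hand_Over P a Q) \<or> (\<exists>J. e = Escrow P a J \<and> P \<in> set (plist J))")
  case True
  then show ?thesis
    using assms that(2,3) by fastforce
next
  case False
  then have "holding_of (step t e \<sigma>) a = Owned P"
    using assms by (cases e) (auto split: holding.splits)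
  then show ?thesis
    using False that(1) by blast
qed

text \<open>\<open>hd p = v\<close> puts the voter among the signers, so a vote needs the voter's
  own signature by whatever route it arrives.\<close>

lemma accepts_self_signed:
  "accepts t S J v p \<Longrightarrow> (v, deal_id (the_deal J), v) \<in> S"
  by (auto simp: accepts_def)

text \<open>The signers form a subset of \<open>plist J\<close>, so a path never earns more than
  \<open>length (plist J)\<close> multiples of \<open>delta J\<close>.\<close>

lemma accepts_before_timeout:
  assumes "accepts t S J v p" "delta J > 0"
  shows "t < start J + real (length (plist J)) * delta J"
proof -
  have "card (set p) \<le> length (plist J)"
    using assms(1) card_mono[of "set (plist J)" "set p"] card_length[of "plist J"]
    by (auto simp: accepts_def)
  then have "real (card (set p)) * delta J \<le> real (length (plist J)) * delta J"
    using assms(2) by (intro mult_right_mono) auto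
  then show ?thesis
    using assms(1) by (auto simp: accepts_def)
qed


section \<open>Invariants of arbitrary executions\<close>

lemma state_at_0: "state_at own tr 0 = init_state own"
  by (simp add: state_at_def)

lemma state_at_Suc:
  "i < length tr \<Longrightarrow>
     state_at own tr (Suc i) = step (time_at tr i) (snd (tr ! i)) (state_at own tr i)"
  by (simp add: state_at_def time_at_def take_Suc_conv_app_nth split: prod.splits)

lemma state_at_overflow: "length tr \<le> i \<Longrightarrow> state_at own tr i = final_state own tr"
  by (simp add: state_at_def final_state_def)

lemma state_at_Suc_cases:
  obtains "i < length tr"
      "state_at own tr (Suc i) = step (time_at tr i) (snd (tr ! i)) (state_at own tr i)"
  | "state_at own tr (Suc i) = state_at own tr i"
  by (metis state_at_Suc state_at_overflow le_SucI not_le)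

lemma permanent_mono:
  assumes "i \<le> k"
  shows "permanent (state_at own tr i) \<subseteq> permanent (state_at own tr k)"
  using assms
proof (induction k rule: dec_induct)
  case (step k)
  then show ?case
    by (cases rule: state_at_Suc_cases[of k tr own]) (use permanent_step_mono in fastforce)+
qed simp

lemma signatures_mono:
  assumes "i \<le> k"
  shows "signatures (state_at own tr i) \<subseteq> signatures (state_at own tr k)"
  using assms
proof (induction k rule: dec_induct)
  case (step k)
  then show ?case
    by (cases rule: state_at_Suc_cases[of k tr own]) (auto simp: step_signatures)
qed simp

text \<open>Unforgeability in terms of the trace: only \<open>Sign\<close> events add signatures.
  The bound on \<open>k\<close> is strict because \<open>state_at\<close> is the state before event
  \<open>i\<close>.\<close>

lemma signature_iff_signed:
  "(s, d, v) \<in> signatures (state_at own tr i) \<longleftrightarrow> (\<exists>k<i. occurs tr k (Sign s d v))"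
proof (induction i)
  case (Suc i)
  show ?case
  proof (cases "i < length tr")
    case True
    then have "(s, d, v) \<in> signatures (state_at own tr (Suc i)) \<longleftrightarrow>
        (s, d, v) \<in> signatures (state_at own tr i) \<or> occurs tr i (Sign s d v)"
      by (auto simp: state_at_Suc step_signatures occurs_def)
    with Suc.IH show ?thesis
      by (auto simp: less_Suc_eq)
  next
    case False
    then have "state_at own tr (Suc i) = state_at own tr i"
      by (simp add: state_at_overflow)
    with False Suc.IH show ?thesis
      by (auto simp: less_Suc_eq occurs_def)
  qed
qed (simp add: state_at_0 init_state_def)

text \<open>Refers to the trace, so that it keeps its meaning after a release has erased the
  contract together with its \<open>voters\<close>.\<close>

definition accepted_vote ::
  "('a \<Rightarrow> 'p) \<Rightarrow> ('d, 'p, 'a) trace \<Rightarrow> ('d, 'p, 'a) info \<Rightarrow> 'a \<Rightarrow> nat \<Rightarrow> 'p \<Rightarrow> 'p list \<Rightarrow> bool" where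
  "accepted_vote own tr J a i v p \<longleftrightarrow>
     occurs tr i (Vote a v p) \<and>
     (\<exists>c. holding_of (state_at own tr i) a = Escrowed c \<and> recorded c = J) \<and>
     accepts (time_at tr i) (signatures (state_at own tr i)) J v p"

text \<open>A vote that completes the list releases the asset in the same step, so a contract that
  still exists lacks some voter. Senders of tentative transfers were commit-owners, who always come
  from the recorded list.\<close>

lemma escrow_invariant:
  assumes "holding_of (state_at own tr i) a = Escrowed c"
  shows "commit_owner c \<in> set (plist (recorded c)) \<and>
    fst ` tentative c \<subseteq> set (plist (recorded c)) \<and>
    \<not> set (plist (recorded c)) \<subseteq> voters c \<and>
    (\<forall>v \<in> voters c. \<exists>k<i. \<exists>p. accepted_vote own tr (recorded c) a k v p)"
  using assms
proof (induction i arbitrary: c)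
  case (Suc i)
  show ?case
  proof (cases rule: state_at_Suc_cases[of i tr own])
    case 1
    from Suc.prems[unfolded 1(2)] show ?thesis
    proof (cases rule: escrowed_stepE)
      case (vote c0 v p)
      then have "accepted_vote own tr (recorded c0) a i v p"
        using 1(1) by (auto simp: accepted_vote_def occurs_def)
      moreover have "\<exists>k<Suc i. \<exists>q. accepted_vote own tr (recorded c0) a k w q"
        if "w \<in> voters c0" for w
        using that Suc.IH[OF vote(1)] less_SucI by blast
      ultimately show ?thesis
        using vote(4,5) Suc.IH[OF vote(1)] by auto
    qed (use Suc.IH less_SucI in \<open>fastforce+\<close>)
  qed (use Suc less_SucI in \<open>metis\<close>)
qed (simp add: state_at_0 init_state_def)

text \<open>Before the timeout no refund can occur. So the contract has either released, which
  \<open>permanent\<close> remembers wherever the asset goes next, or it still exists and has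
  recorded every vote accepted since \<open>j\<close>.\<close>

lemma escrow_progress:
  assumes "holding_of (state_at own tr j) b = Escrowed cb" "recorded cb = J"
    and "j \<le> n" "n \<le> length tr"
    and "\<And>i. j \<le> i \<Longrightarrow> i < n \<Longrightarrow>
      time_at tr i < start J + real (length (plist J)) * delta J"
  shows "tag b (tentative cb) \<subseteq> permanent (state_at own tr n) \<or>
    (\<exists>c. holding_of (state_at own tr n) b = Escrowed c \<and> recorded c = J \<and>
      tentative cb \<subseteq> tentative c \<and>
      (\<forall>m v p. j \<le> m \<and> m < n \<and> occurs tr m (Vote b v p) \<and>
        accepts (time_at tr m) (signatures (state_at own tr m)) J v p \<longrightarrow> v \<in> voters c))"
  using assms(3-5)
proof (induction n rule: dec_induct)
  case base
  then show ?case using assms(1,2) by auto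
next
  case (step n)
  let ?\<sigma> = "state_at own tr n"
  have Suc: "state_at own tr (Suc n) = Defs.step (time_at tr n) (snd (tr ! n)) ?\<sigma>"
    using step.prems by (simp add: state_at_Suc)
  consider (released) "tag b (tentative cb) \<subseteq> permanent ?\<sigma>"
    | (held) c where "holding_of ?\<sigma> b = Escrowed c" "recorded c = J"
      "tentative cb \<subseteq> tentative c"
      "\<And>m v p. j \<le> m \<Longrightarrow> m < n \<Longrightarrow> occurs tr m (Vote b v p) \<Longrightarrow>
        accepts (time_at tr m) (signatures (state_at own tr m)) J v p \<Longrightarrow> v \<in> voters c"
  proof -
    have "i < Suc n" if "i < n" for i using that by simp
    with step.IH step.prems show thesis
      using released held by (meson Suc_leD)
  qed
  then show ?case
  proof cases
    case released
    then show ?thesis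
      using permanent_mono[of n "Suc n" own tr] by auto
  next
    case held
    from held(1) show ?thesis
    proof (cases rule: step_escrowedE[where t = "time_at tr n" and e = "snd (tr ! n)"])
      case (stays c')
      then show ?thesis
        using held unfolding Suc
        by (intro disjI2 exI[of _ c']) (auto simp: less_Suc_eq occurs_def)
    next
      case (release v p)
      then show ?thesis
        using held(3) unfolding Suc by (auto simp: tag_def)
    next
      case refund
      then show ?thesis
        using held(2) step.prems(2)[of n] step.hyps by simp
    qed
  qed
qed

lemma time_at_mono:
  "sorted (map fst tr) \<Longrightarrow> i \<le> k \<Longrightarrow> k < length tr \<Longrightarrow> time_at tr i \<le> time_at tr k"
  using sorted_nth_mono[of "map fst tr" i k] by (simp add: time_at_def)


section \<open>Executions from the viewpoint of a compliant party\<close>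

text \<open>Fixes the validation index \<open>j\<close> that \<open>compliant\<close> hides under an
  existential. Nothing is assumed about the behaviour of any other party.\<close>

locale compliant_party =
  fixes own :: "'a \<Rightarrow> 'p" and J :: "('d, 'p, 'a) info" and S :: "'a payoff set"
    and tr :: "('d, 'p, 'a) trace" and X :: 'p and j :: nat
  assumes chronological: "sorted (map fst tr)"
    and member: "X \<in> set (plist J)"
    and delta_pos: "delta J > 0"
    and validates: "occurs tr j (Validate X)" "time_at tr j < start J"
    and escrow_phase: "escrow_phase own J tr X j"
    and transfer_phase: "transfer_phase own J tr X j"
    and commit_phase: "commit_phase own J S tr X j"
begin

abbreviation \<sigma> :: "nat \<Rightarrow> ('d, 'p, 'a) state" where
  "\<sigma> \<equiv> state_at own tr"

abbreviation deadline :: real where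
  "deadline \<equiv> start J + real (length (plist J)) * delta J"

section \<open>Nothing leaves without the party's own signature\<close>

lemma no_hand_over: "\<not> occurs tr i (Hand_Over X a Q)"
  using escrow_phase by (simp add: escrow_phase_def)

lemma no_late_transfer: "occurs tr i (Transfer X a Q) \<Longrightarrow> i < j"
  using transfer_phase by (simp add: transfer_phase_def)

lemma signs_after_validation:
  "(X, d, v) \<in> signatures (\<sigma> i) \<Longrightarrow> validation_ok own J S tr X j \<and> j < i"
  using commit_phase by (fastforce simp: signature_iff_signed commit_phase_def)

text \<open>The vote of \<open>X\<close> is either the completing one or already among
  \<open>voters\<close>, where the invariant traces it to an earlier acceptance. The contract may
  record any deal, hence the unspecified \<open>d\<close>.\<close>

lemma release_requires_signature:
  assumes "holding_of (\<sigma> i) a = Escrowed c" "X \<in> set (plist (recorded c))"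
    and "accepts (time_at tr i) (signatures (\<sigma> i)) (recorded c) v p"
    and "set (plist (recorded c)) \<subseteq> insert v (voters c)"
  shows "\<exists>d. (X, d, X) \<in> signatures (\<sigma> i)"
proof (cases "X = v")
  case True
  then show ?thesis using accepts_self_signed[OF assms(3)] by blast
next
  case False
  then have "X \<in> voters c" using assms(2,4) by auto
  then obtain k q where "k < i" "accepted_vote own tr (recorded c) a k X q"
    using escrow_invariant[OF assms(1)] by blast
  then show ?thesis
    using accepts_self_signed signatures_mono[of k i own tr]
    by (fastforce simp: accepted_vote_def)
qed

text \<open>\<open>X\<close> hands nothing over, and a contract with \<open>X\<close> as a sender
  also lists \<open>X\<close>, so its release needs the vote of \<open>X\<close>. Together with
  \<open>signs_after_validation\<close>, any asset given away proves that validation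
  succeeded.\<close>

lemma given_requires_signature:
  "(X, Q, a) \<in> permanent (\<sigma> i) \<Longrightarrow> \<exists>d. (X, d, X) \<in> signatures (\<sigma> i)"
proof (induction i)
  case (Suc i)
  have mono: "signatures (\<sigma> i) \<subseteq> signatures (\<sigma> (Suc i))"
    by (simp add: signatures_mono)
  show ?case
  proof (cases rule: state_at_Suc_cases[of i tr own])
    case 1
    from Suc.prems[unfolded 1(2)] show ?thesis
    proof (cases rule: permanent_stepE)
      case 1
      then show ?thesis using Suc.IH mono by blast
    next
      case 2
      then show ?thesis using no_hand_over \<open>i < length tr\<close> by (auto simp: occurs_def)
    next
      case (3 c v p)
      then have "X \<in> set (plist (recorded c))"
        using escrow_invariant[OF 3(2)] by force
      then show ?thesis
        using release_requires_signature[OF 3(2) _ 3(3,4)] mono by blast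
    qed
  qed (use Suc in simp)
qed (simp add: state_at_0 init_state_def)

section \<open>Own assets up to validation\<close>

text \<open>Until \<open>j\<close> a contract with data \<open>J\<close> can neither release, as
  \<open>X\<close> has not signed, nor refund, as validation precedes \<open>start J\<close>. The
  clause on missing \<open>Escrow\<close> events lets the escrow that \<open>X\<close> performs
  before \<open>j\<close> exclude the first alternative.\<close>

lemma own_asset_until_validation:
  assumes "a \<in> outgoing (the_deal J) X" "own a = X" "i \<le> j"
  shows "holding_of (\<sigma> i) a = Owned X \<and> (\<forall>k<i. \<not> occurs tr k (Escrow X a J)) \<or>
    (\<exists>c. holding_of (\<sigma> i) a = Escrowed c \<and> recorded c = J)"
  using assms(3)
proof (induction i)
  case 0
  then show ?case using assms(2) by (simp add: state_at_0 init_state_def)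
next
  case (Suc i)
  have i: "i < length tr" using Suc.prems validates(1) by (simp add: occurs_def)
  note eq = state_at_Suc[OF i, of own]
  consider (owned) "holding_of (\<sigma> i) a = Owned X" "\<And>k. k < i \<Longrightarrow> \<not> occurs tr k (Escrow X a J)"
    | (held) c where "holding_of (\<sigma> i) a = Escrowed c" "recorded c = J"
    using Suc by auto
  then show ?case
  proof cases
    case owned
    from owned(1) show ?thesis
    proof (cases rule: owned_stepE[where t = "time_at tr i" and e = "snd (tr ! i)"])
      \<comment> \<open>The event is no escrow by \<open>X\<close> with data \<open>J\<close>: as
        \<open>X\<close> is in \<open>plist J\<close>, that call would have succeeded.\<close>
      case 1
      then show ?thesis
        using owned(2) member i unfolding eq by (auto simp: less_Suc_eq occurs_def)
    next
      case (2 Q)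
      then show ?thesis using no_hand_over i by (auto simp: occurs_def)
    next
      case (3 J' c)
      then have "J' = J" using escrow_phase i by (auto simp: escrow_phase_def occurs_def)
      with 3 show ?thesis unfolding eq by auto
    qed
  next
    case held
    from held(1) show ?thesis
    proof (cases rule: step_escrowedE[where t = "time_at tr i" and e = "snd (tr ! i)"])
      case (stays c')
      then show ?thesis using held(2) unfolding eq by auto
    next
      case (release v p)
      then show ?thesis
        using release_requires_signature[OF held(1) _ release(2,3)] member held(2)
          signs_after_validation Suc.prems by fastforce
    next
      \<comment> \<open>A refund here would happen no later than validation, thus before
        \<open>start J\<close>, while the timeout is at least \<open>start J\<close>.\<close>
      case refund
      have "time_at tr i \<le> time_at tr j"
        using time_at_mono[OF chronological] Suc.prems validates(1) by (simp add: occurs_def)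
      moreover have "0 \<le> real (length (plist J)) * delta J"
        using delta_pos by simp
      ultimately show ?thesis
        using refund held(2) validates(2) by simp
    qed
  qed
qed

lemma own_asset_escrowed_at_validation:
  assumes "a \<in> outgoing (the_deal J) X" "own a = X"
  shows "\<exists>c. holding_of (\<sigma> j) a = Escrowed c \<and> recorded c = J"
proof -
  have "\<exists>i<j. occurs tr i (Escrow X a J)"
    using escrow_phase assms unfolding escrow_phase_def by blast
  with own_asset_until_validation[OF assms order_refl] show ?thesis by blast
qed

section \<open>Outgoing transfers after validation\<close>

text \<open>After \<open>j\<close>, \<open>X\<close> makes no tentative transfer, and a newly
  created contract starts with none. So every later contract with \<open>X\<close> as a sender
  carries over a transfer already present at \<open>j\<close>, and its release shows that all
  parties' votes were accepted under \<open>J\<close>.\<close>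

lemma given_after_validation:
  assumes out: "\<And>c. holding_of (\<sigma> j) a = Escrowed c \<Longrightarrow> recorded c = J"
    and "j \<le> i"
  shows "(\<forall>c Q. holding_of (\<sigma> i) a = Escrowed c \<and> (X, Q) \<in> tentative c \<longrightarrow>
      recorded c = J \<and> (X, Q, a) \<in> tentative_transfers (\<sigma> j)) \<and>
    (\<forall>Q. (X, Q, a) \<in> permanent (\<sigma> i) \<longrightarrow>
      (X, Q, a) \<in> tentative_transfers (\<sigma> j) \<and>
      (\<forall>v \<in> set (plist J). \<exists>k p. accepted_vote own tr J a k v p))"
    (is "?held i \<and> ?given i")
  using assms(2)
proof (induction i rule: dec_induct)
  case base
  \<comment> \<open>At \<open>j\<close> itself \<open>X\<close> has signed nothing yet, so it has
    given nothing.\<close>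
  have "(X, Q, a) \<notin> permanent (\<sigma> j)" for Q
    using given_requires_signature signs_after_validation by blast
  moreover have "(X, Q, a) \<in> tentative_transfers (\<sigma> j)"
    if "holding_of (\<sigma> j) a = Escrowed c" "(X, Q) \<in> tentative c" for c Q
    using that by (auto simp: tentative_transfers_def)
  ultimately show ?case
    using out by blast
next
  case (step i)
  have held: "recorded c = J \<and> (X, Q, a) \<in> tentative_transfers (\<sigma> j)"
    if "holding_of (\<sigma> i) a = Escrowed c" "(X, Q) \<in> tentative c" for c Q
    using step.IH that by blast
  show ?case
  proof (cases rule: state_at_Suc_cases[of i tr own])
    case 1
    have "?held (Suc i)"
    proof (intro allI impI, elim conjE)
      fix c Q
      assume esc: "holding_of (\<sigma> (Suc i)) a = Escrowed c" and XQ: "(X, Q) \<in> tentative c"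
      from esc[unfolded 1(2)] show "recorded c = J \<and> (X, Q, a) \<in> tentative_transfers (\<sigma> j)"
      proof (cases rule: escrowed_stepE)
        case (transfer c0 P R)
        then have "P \<noteq> X"
          using no_late_transfer[of i a R] 1(1) step.hyps by (auto simp: occurs_def)
        then have "(X, Q) \<in> tentative c0" "recorded c = recorded c0"
          using transfer(5) XQ by auto
        with held[OF transfer(1)] show ?thesis by simp
      next
        case same
        then show ?thesis using held XQ by blast
      next
        case (vote c0 v p)
        then show ?thesis using held[OF vote(1), of Q] XQ by simp
      qed (use XQ in simp)
    qed
    moreover have "?given (Suc i)"
    proof (intro allI impI)
      fix Q
      assume "(X, Q, a) \<in> permanent (\<sigma> (Suc i))"
      from this[unfolded 1(2)]
      show "(X, Q, a) \<in> tentative_transfers (\<sigma> j) \<and>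
        (\<forall>v \<in> set (plist J). \<exists>k p. accepted_vote own tr J a k v p)"
      proof (cases rule: permanent_stepE)
        case 2
        then show ?thesis using no_hand_over 1(1) by (auto simp: occurs_def)
      next
        case (3 c v p)
        have c: "recorded c = J" "(X, Q, a) \<in> tentative_transfers (\<sigma> j)"
          using held[OF 3(2,5)] by auto
        have "accepted_vote own tr J a i v p"
          using 3(1-3) c(1) 1(1) by (auto simp: accepted_vote_def occurs_def)
        \<comment> \<open>The completing vote is the current event; all others were recorded, and
          the invariant supplies their acceptances.\<close>
        then have "\<exists>k p. accepted_vote own tr J a k w p" if "w \<in> set (plist J)" for w
          using that 3(4) c(1) escrow_invariant[OF 3(2)] by blast
        with c show ?thesis by blast
      next
        case 1
        then show ?thesis using conjunct2[OF step.IH] by blast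
      qed
    qed
    ultimately show ?thesis by blast
  next
    case 2
    show ?thesis unfolding 2 by (rule step.IH)
  qed
qed

section \<open>Delivery of votes to the incoming contracts\<close>

lemma final_stateI: "\<exists>i\<ge>j. \<sigma> i = final_state own tr"
  using validates(1) by (auto simp: occurs_def final_state_def intro!: exI[of _ "length tr"])

text \<open>The own vote is sent directly, any other is forwarded with one more signature. The
  conclusion tests the arriving vote against \<open>J\<close> only; whether the contract of
  \<open>b\<close> still exists at that moment is settled separately.\<close>

lemma accepted_vote_reaches_incoming:
  assumes "validation_ok own J S tr X j"
    and "a \<in> outgoing (the_deal J) X" "accepted_vote own tr J a i v p"
    and "b \<in> incoming (the_deal J) X"
  shows "\<exists>m\<ge>j. \<exists>q. occurs tr m (Vote b v q) \<and>
    accepts (time_at tr m) (signatures (\<sigma> m)) J v q"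
proof (cases "v = X")
  case True
  obtain k m where "k > j" and sign: "occurs tr k (Sign X (deal_id (the_deal J)) X)"
    and "m > k" and vote: "occurs tr m (Vote b X [X])" "time_at tr m < start J + delta J"
    using commit_phase assms(1,4) unfolding commit_phase_def votes_directly_def by blast
  then have "accepts (time_at tr m) (signatures (\<sigma> m)) J X [X]"
    using member by (auto simp: accepts_def signature_iff_signed)
  with True vote \<open>k > j\<close> \<open>m > k\<close> show ?thesis
    by (intro exI[of _ m]) auto
next
  case False
  have "observed_vote own J tr X i v p"
    using assms(2,3) by (auto simp: observed_vote_def accepted_vote_def)
  \<comment> \<open>The vote forwarded may be an earlier one of \<open>v\<close>, with a path
    \<open>q\<close> different from \<open>p\<close>.\<close>
  then obtain i' where "forwards own J tr X j i' v"
    using commit_phase assms(1) False by (fastforce simp: commit_phase_def)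
  then obtain q k m where obs: "observed_vote own J tr X i' v q" and "X \<notin> set q"
    and k: "k > max i' j" "occurs tr k (Sign X (deal_id (the_deal J)) v)"
    and m: "m > k" "occurs tr m (Vote b v (q @ [X]))"
      "time_at tr m \<le> max (time_at tr i') (time_at tr j) + delta J"
    using assms(4) by (fastforce simp: forwards_def)
  from obs have acc: "accepts (time_at tr i') (signatures (\<sigma> i')) J v q"
    by (auto simp: observed_vote_def)
  \<comment> \<open>If the vote was accepted before validation, the delay runs from
    \<open>j\<close>, which also lies before \<open>start J\<close>.\<close>
  have "max (time_at tr i') (time_at tr j) < start J + real (card (set q)) * delta J"
    using acc validates(2) delta_pos
    by (auto simp: accepts_def intro: less_le_trans)
  \<comment> \<open>As \<open>X\<close> is not in \<open>q\<close>, the number of distinct signers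
    rises by exactly one, which absorbs the delay \<open>delta J\<close>.\<close>
  then have "time_at tr m < start J + real (card (set (q @ [X]))) * delta J"
    using m(3) \<open>X \<notin> set q\<close> by (auto simp: algebra_simps max_def split: if_splits)
  moreover have "signatures (\<sigma> i') \<subseteq> signatures (\<sigma> m)"
    using k m by (intro signatures_mono) simp
  moreover have "(X, deal_id (the_deal J), v) \<in> signatures (\<sigma> m)"
    using k m by (auto simp: signature_iff_signed)
  ultimately have "accepts (time_at tr m) (signatures (\<sigma> m)) J v (q @ [X])"
    using acc member \<open>X \<notin> set q\<close> by (auto simp: accepts_def)
  with k m show ?thesis
    by (intro exI[of _ m]) auto
qed

text \<open>If the contract of \<open>b\<close> had not released by the deadline, it would still
  exist and would have recorded the vote of every party, which the invariant forbids.\<close>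

lemma incoming_released:
  assumes ok: "validation_ok own J S tr X j"
    and a: "a \<in> outgoing (the_deal J) X"
    and voted: "\<And>v. v \<in> set (plist J) \<Longrightarrow> \<exists>k p. accepted_vote own tr J a k v p"
    and b: "b \<in> incoming (the_deal J) X"
    and R: "(R, X, b) \<in> tentative_transfers (\<sigma> j)"
  shows "(R, X, b) \<in> permanent (final_state own tr)"
proof -
  obtain cb where cb: "holding_of (\<sigma> j) b = Escrowed cb" "recorded cb = J"
    using ok b by (auto simp: validation_ok_def)
  \<comment> \<open>By chronological order \<open>early\<close> is an initial segment of the
    indices, and \<open>n\<close> is its length: all events before \<open>n\<close>, and no others,
    precede the deadline. It contains \<open>j\<close>, so the maximum exists.\<close>
  define early where "early = {m. m < length tr \<and> time_at tr m < deadline}"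
  define n where "n = Suc (Max early)"
  have fin: "finite early" by (simp add: early_def)
  have "start J \<le> deadline" using delta_pos by simp
  then have "j \<in> early"
    using validates by (simp add: early_def occurs_def)
  then have "Max early \<in> early" using fin Max_in by blast
  then have n: "n \<le> length tr" "\<And>m. m < n \<Longrightarrow> time_at tr m < deadline"
    using time_at_mono[OF chronological, of _ "Max early"]
    by (auto simp: n_def early_def less_Suc_eq_le intro: le_less_trans)
  have early: "m < n" if "m \<in> early" for m
    using that fin by (simp add: n_def less_Suc_eq_le)
  have "tag b (tentative cb) \<subseteq> permanent (\<sigma> n)"
  proof (rule ccontr)
    assume "\<not> ?thesis"
    then obtain c where c: "holding_of (\<sigma> n) b = Escrowed c" "recorded c = J"
      and cv: "\<And>m v p. j \<le> m \<Longrightarrow> m < n \<Longrightarrow> occurs tr m (Vote b v p) \<Longrightarrow>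
        accepts (time_at tr m) (signatures (\<sigma> m)) J v p \<Longrightarrow> v \<in> voters c"
      using escrow_progress[OF cb less_imp_le[OF early[OF \<open>j \<in> early\<close>]] n(1) n(2)] by blast
    have "v \<in> voters c" if v: "v \<in> set (plist J)" for v
    proof -
      obtain k p where "accepted_vote own tr J a k v p" using voted v by blast
      from accepted_vote_reaches_incoming[OF ok a this b] obtain m q where
        "j \<le> m" and m: "occurs tr m (Vote b v q)"
        "accepts (time_at tr m) (signatures (\<sigma> m)) J v q" by blast
      \<comment> \<open>An acceptable path always arrives before the timeout, so this vote falls
        within the range covered by \<open>cv\<close>.\<close>
      moreover have "m \<in> early"
        using accepts_before_timeout[OF m(2) delta_pos] m(1) by (simp add: early_def occurs_def)
      ultimately show ?thesis using cv early by blast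
    qed
    then show False
      using escrow_invariant[OF c(1)] c(2) by blast
  qed
  then show ?thesis
    using R cb permanent_mono[OF n(1), of own tr]
    by (auto simp: tentative_transfers_def tag_def final_state_def)
qed

section \<open>Acceptability of the final payoff\<close>

lemma payoff_acceptable:
  assumes among: "\<And>P Q a. (P, Q, a) \<in> transfers (the_deal J) \<Longrightarrow>
      own a = P \<or> (\<exists>R. (R, P, a) \<in> transfers (the_deal J))"
    and S: "acceptability (the_deal J) X S"
  shows "final_payoff own J tr X \<in> S"
proof -
  obtain I G where payoff: "final_payoff own J tr X = (I, G)" by fastforce
  have I: "I = {b \<in> incoming (the_deal J) X. \<exists>R. (R, X, b) \<in> permanent (final_state own tr)}"
    and G: "G = {a \<in> outgoing (the_deal J) X. \<exists>Q. (X, Q, a) \<in> permanent (final_state own tr)}"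
    using payoff by (auto simp: final_payoff_def payoff_of_def)
  \<comment> \<open>\<open>acceptability\<close> is closed under strict improvements only; this
    version also admits equality.\<close>
  have better: "(I, G) \<in> S" if "(I', G') \<in> S" "I' \<subseteq> I" "G \<subseteq> G'" for I' G'
  proof (cases "(I, G) = (I', G')")
    case False
    then have "I' \<subset> I \<and> G \<subseteq> G' \<or> I' \<subseteq> I \<and> G \<subset> G'" using that by blast
    moreover have "I \<subseteq> incoming (the_deal J) X" "G \<subseteq> outgoing (the_deal J) X"
      using I G by auto
    ultimately show ?thesis using S that(1) unfolding acceptability_def by blast
  qed (use that in simp)
  have "(I, G) \<in> S"
  \<comment> \<open>A party that gives nothing is compared with NOTHING, any other with the payoff
    it validated.\<close>
  proof (cases "G = {}")
    case True
    then show ?thesis using better[of "{}" "{}"] S by (simp add: acceptability_def)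
  next
    case False
    obtain n where n: "j \<le> n" "\<sigma> n = final_state own tr" using final_stateI by blast
    obtain a Q where aQ: "a \<in> outgoing (the_deal J) X" "(X, Q, a) \<in> permanent (final_state own tr)"
      using False G by auto
    then have ok: "validation_ok own J S tr X j"
      using given_requires_signature[of Q a n] signs_after_validation[of _ _ n] n(2) by auto
    \<comment> \<open>An outgoing asset is either owned initially, hence escrowed by
      \<open>X\<close> itself, or relayed, hence incoming and checked at validation.\<close>
    have esc: "recorded c = J"
      if "a \<in> outgoing (the_deal J) X" "holding_of (\<sigma> j) a = Escrowed c" for a c
    proof -
      have "own a = X \<or> a \<in> incoming (the_deal J) X"
        using among that(1) by (auto simp: outgoing_def incoming_def)
      then have "\<exists>c. holding_of (\<sigma> j) a = Escrowed c \<and> recorded c = J"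
        using own_asset_escrowed_at_validation that(1) ok by (auto simp: validation_ok_def)
      then show ?thesis using that(2) by auto
    qed
    have given: "(X, Q, a) \<in> tentative_transfers (\<sigma> j)"
        "\<And>v. v \<in> set (plist J) \<Longrightarrow> \<exists>k p. accepted_vote own tr J a k v p"
      if "a \<in> outgoing (the_deal J) X" "(X, Q, a) \<in> permanent (final_state own tr)" for a Q
      using given_after_validation[of a n] esc that n by auto
    have "payoff_of (the_deal J) (tentative_transfers (\<sigma> j)) X \<in> S"
      using ok by (simp add: validation_ok_def)
    then show ?thesis
      unfolding payoff_of_def
    proof (rule better)
      show "{b \<in> incoming (the_deal J) X. \<exists>R. (R, X, b) \<in> tentative_transfers (\<sigma> j)} \<subseteq> I"
        using incoming_released[OF ok aQ(1) given(2)[OF aQ]] I by blast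
      show "G \<subseteq> {a \<in> outgoing (the_deal J) X. \<exists>Q. (X, Q, a) \<in> tentative_transfers (\<sigma> j)}"
        using given(1) G by blast
    qed
  qed
  then show ?thesis using payoff by simp
qed

end

theorem theorem1:
  fixes D :: "('d, 'p, 'a) deal" and ps :: "'p list" and t0 \<Delta> :: real
    and own :: "'a \<Rightarrow> 'p" and acc :: "'p \<Rightarrow> 'a payoff set"
    and C :: "'p set" and tr :: "('d, 'p, 'a) trace"
  defines "J \<equiv> \<lparr>the_deal = D, plist = ps, start = t0, delta = \<Delta>\<rparr>"
  assumes "deal_among own D ps"
    and "well_formed D ps"
    and "\<Delta> > 0"
    and "\<forall>P \<in> set ps. acceptability D P (acc P)"
    and "C \<subseteq> set ps"
    and "execution own J acc C tr"
  shows "\<forall>X \<in> C. final_payoff own J tr X \<in> acc X"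
proof
  fix X assume X: "X \<in> C"
  then obtain j where j: "occurs tr j (Validate X)" "time_at tr j < start J"
      "escrow_phase own J tr X j" "transfer_phase own J tr X j"
      "commit_phase own J (acc X) tr X j"
    using assms(7) by (auto simp: execution_def compliant_def)
  interpret compliant_party own J "acc X" tr X j
    using j X assms(4,6,7) by unfold_locales (auto simp: J_def execution_def)
  show "final_payoff own J tr X \<in> acc X"
    using assms(2,5,6) X
    by (intro payoff_acceptable) (auto simp: J_def deal_among_def)
qed

end
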